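(* For any game with activeness $G^g$ and any option $G'^{g'}\in G^g$, $G^g\neq G'^{g'}$.
   Context: Let $\mathcal{B}=\{0,1\}$. Define $\mathbb{I}_0=\{\emptyset\}\times\mathcal{B}$ and $\mathbb{I}_n=2^{\mathbb{I}_{n-1}}\times\mathcal{B}$ for $n\ge1$; a game with activeness is an element of $\mathbb{I}=\bigcup_{n\ge0}\mathbb{I}_n$. A pair $(G,g)$ is written $G^g$; elements of $G$ are its options, $g=1$ meaning active. The outcome $o$ is defined recursively: $o(G^g)=\mathscr{N}$ if $g=1$ and some option has outcome $\mathscr{P}$, and $o(G^g)=\mathscr{P}$ otherwise. The sum is $G^g+H^h=(\{G'^{g'}+H^h:G'^{g'}\in G^g\}\cup\{G^g+H'^{h'}:H'^{h'}\in H^h\})^{\max\{g,h\}}$. $G^g=H^h$ means $o(G^g+X^x)=o(H^h+X^x)$ for all games $X^x$; $G^g\ne H^h$ is its negation. *)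

theory Defs
  imports Main "HOL-Library.FSet"
begin

text \<open>
  Each stage \<open>\<I>\<^sub>n\<close> is finite (\<open>finite_stage\<close>), so all its subsets are finite and the games with
  activeness are exactly the hereditarily finite objects of the datatype below
  (\<open>UN_stage\<close>), with \<open>True\<close> meaning active.
\<close>

datatype game = Game (options: "game fset") (active: bool)

primrec stage :: "nat \<Rightarrow> game set" where
  "stage 0 = {Game {||} b | b. True}"
| "stage (Suc n) = {Game A b | A b. fset A \<subseteq> stage n}"

lemma stage_mono: "m \<le> n \<Longrightarrow> stage m \<subseteq> stage n"
proof (rule lift_Suc_mono_le[where f = stage])
  show "stage n \<subseteq> stage (Suc n)" for n
    by (induction n) auto
qed

lemma finite_stage: "finite (stage n)"
proof (induction n)
  case 0
  have "stage 0 = range (Game {||})" by auto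
  then show ?case by simp
next
  case (Suc n)
  have "stage (Suc n) \<subseteq> (\<lambda>(A, b). Game (Abs_fset A) b) ` (Pow (stage n) \<times> UNIV)"
  proof
    fix x assume "x \<in> stage (Suc n)"
    then obtain A b where "x = Game A b" "fset A \<subseteq> stage n" by auto
    then show "x \<in> (\<lambda>(A, b). Game (Abs_fset A) b) ` (Pow (stage n) \<times> UNIV)"
      by (intro image_eqI[of _ _ "(fset A, b)"]) (auto simp: fset_inverse)
  qed
  moreover have "finite (Pow (stage n) \<times> (UNIV :: bool set))" using Suc by simp
  ultimately show ?case by (meson finite_imageI finite_subset)
qed

lemma UN_stage: "(\<Union>n. stage n) = UNIV"
proof -
  have "\<exists>n. x \<in> stage n" for x
  proof (induction x)
    case (Game A b)
    then obtain f where f: "\<And>y. y |\<in>| A \<Longrightarrow> y \<in> stage (f y)" by metis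
    define N where "N = Max (insert 0 (f ` fset A))"
    have "f y \<le> N" if "y |\<in>| A" for y
      unfolding N_def using that by (intro Max_ge) auto
    with f have "fset A \<subseteq> stage N"
      using stage_mono by blast
    then have "Game A b \<in> stage (Suc N)" by auto
    then show ?case ..
  qed
  then show ?thesis by auto
qed

datatype outcome_class = \<N> | \<P>

primrec outcome :: "game \<Rightarrow> outcome_class" where
  "outcome (Game G g) = (if g \<and> \<P> |\<in>| outcome |`| G then \<N> else \<P>)"

lemma outcome_eq_N_iff:
  "outcome G = \<N> \<longleftrightarrow> active G \<and> (\<exists>G'. G' |\<in>| options G \<and> outcome G' = \<P>)"
  by (cases G) force

lemma size_option: "x |\<in>| G \<Longrightarrow> size x < size (Game G g)"
proof -
  assume "x |\<in>| G"
  then have "size x \<le> (\<Sum>y\<in>fset G. Suc (size y))"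
    using member_le_sum[of x "fset G" "\<lambda>y. Suc (size y)"] by simp
  then show ?thesis by (simp add: size_fset_simps)
qed

function game_sum :: "game \<Rightarrow> game \<Rightarrow> game" (infixl \<open>\<oplus>\<close> 65) where
  "Game G g \<oplus> Game H h =
     Game ((\<lambda>G'. G' \<oplus> Game H h) |`| G |\<union>| (\<lambda>H'. Game G g \<oplus> H') |`| H) (max g h)"
  by pat_completeness auto
termination
  by (relation "measure (\<lambda>(x, y). size x + size y)") (auto dest: size_option simp del: game.size)

definition game_eq :: "game \<Rightarrow> game \<Rightarrow> bool" (infix \<open>\<doteq>\<close> 50) where
  "G \<doteq> H \<longleftrightarrow> (\<forall>X. outcome (G \<oplus> X) = outcome (H \<oplus> X))"

end

theory Submission imports Defs begin

text \<open>
  Let \<open>X\<close> be \<open>G'\<close> with every position made active. Every position of \<open>G' \<oplus> X\<close> reached by mirror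
  play is a sum with an active component, so the player moving second can always answer in the
  other component and \<open>G' \<oplus> X\<close> has outcome \<open>\<P>\<close>. As \<open>X\<close> is active, so is \<open>G \<oplus> X\<close>, and the move
  to \<open>G' \<oplus> X\<close> shows that it has outcome \<open>\<N>\<close>.
\<close>

lemma active_game_sum [simp]: "active (G \<oplus> H) \<longleftrightarrow> active G \<or> active H"
  by (cases G; cases H) (auto simp: max_def)

lemma options_game_sum:
  "options (G \<oplus> H) = (\<lambda>G'. G' \<oplus> H) |`| options G |\<union>| (\<lambda>H'. G \<oplus> H') |`| options H"
  by (cases G; cases H) simp

lemma outcome_eq_P_iff:
  "outcome G = \<P> \<longleftrightarrow> \<not> active G \<or> (\<forall>G'. G' |\<in>| options G \<longrightarrow> outcome G' = \<N>)"
  using outcome_eq_N_iff[of G] by (metis outcome_class.exhaust outcome_class.distinct(1))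

primrec activate :: "game \<Rightarrow> game" where
  "activate (Game A b) = Game (activate |`| A) True"

lemma active_activate [simp]: "active (activate G)"
  by (cases G) simp

lemma options_activate: "options (activate G) = activate |`| options G"
  by (cases G) simp

lemma outcome_sum_activate: "outcome (G \<oplus> activate G) = \<P>"
proof (induction G)
  case (Game A b)
  let ?G = "Game A b"
  have "outcome K = \<N>" if "K |\<in>| options (?G \<oplus> activate ?G)" for K
  proof -
    \<comment> \<open>Options of \<open>activate ?G\<close> are activated options of
      \<open>?G\<close>, so a move in either summand is described by one \<open>G'\<close> from
      \<open>A\<close>.\<close>
    from that obtain G' where G': "G' |\<in>| A" and
      K: "K = G' \<oplus> activate ?G \<or> K = ?G \<oplus> activate G'"
      by (auto simp: options_game_sum options_activate simp del: activate.simps)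
    \<comment> \<open>The mirror reply makes the matching move in the untouched summand, which
      restores the shape covered by the induction hypothesis.\<close>
    have "G' \<oplus> activate G' |\<in>| options K"
      using G' K by (auto simp: options_game_sum options_activate simp del: activate.simps)
    \<comment> \<open>The right summand of \<open>K\<close> is an image of \<open>activate\<close>
      in both cases, so the reply is legal even if the left summand is inactive.\<close>
    moreover have "active K"
      using K by (auto simp del: activate.simps)
    ultimately show ?thesis
      using Game.IH G' by (auto simp: outcome_eq_N_iff)
  qed
  then show ?case by (simp add: outcome_eq_P_iff del: activate.simps)
qed

theorem theorem3p24:
  fixes G G' :: game
  assumes "G' |\<in>| options G"
  shows "\<not> G \<doteq> G'"
proof -
  have "G' \<oplus> activate G' |\<in>| options (G \<oplus> activate G')"
    using assms by (simp add: options_game_sum)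
  then have "outcome (G \<oplus> activate G') = \<N>"
    using outcome_sum_activate by (auto simp: outcome_eq_N_iff)
  then show ?thesis
    using outcome_sum_activate[of G'] unfolding game_eq_def by (metis outcome_class.distinct(1))
qed

end
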